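(* Let $G$ be a finite graph, $d$ a positive integer and $\mathbf r=(r_1,\dots,r_d)$ with $r_i\ge 4$ for all $i$. Then $$\psi\big(M^{(d)}_{\mathbf r}(G)\big)\le\psi(G)+\left\lfloor\frac d2\right\rfloor+2.$$ Moreover, for $G=K_2$ the sharper bound $\psi\big(M^{(d)}_{\mathbf r}(K_2)\big)\le\left\lceil\frac d2\right\rceil+3$ holds.
   Context: For a positive integer $r$ let $P$ be the path on vertices $0,1,\dots,r$ (edges $\{i-1,i\}$) with an additional loop at $0$. The generalized Mycielskian $M_r(G)$ is obtained from the direct product $P\times G$ (vertices $(a,u)$, with $(a,u)\sim(a',u')$ iff $\{a,a'\}\in E(P)$, the loop allowing $a=a'=0$, and $\{u,u'\}\in E(G)$) by identifying all vertices with first coordinate $r$ into a single vertex. For $\mathbf r=(r_1,\dots,r_d)$, $M^{(d)}_{\mathbf r}(G)=M_{r_d}(M_{r_{d-1}}(\cdots M_{r_1}(G)\cdots))$. The local chromatic number is $\psi(G)=\min_c\max_{v}|\{c(u):u\in N(v)\}|+1$ over proper colorings $c$, $N(v)$ the neighbourhood of $v$. *)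

theory Defs
  imports Complex_Main "Graph_Theory.Kuratowski"
begin

text \<open>
  Finite simple graphs are rendered by the locale \<open>pair_graph\<close>: finite, loopless, symmetric
  digraphs whose arcs are ordered pairs. Thus an edge \<open>{u,v}\<close> is the pair of arcs \<open>(u,v)\<close>,
  \<open>(v,u)\<close>, the neighbourhood of \<open>v\<close> is \<open>parcs G `` {v}\<close>, and a loop at \<open>v\<close> is the arc \<open>(v,v)\<close>.
\<close>

definition proper_coloring :: "'a pair_pre_digraph \<Rightarrow> ('a \<Rightarrow> 'c) \<Rightarrow> bool" where
  "proper_coloring G c \<longleftrightarrow> (\<forall>(u, v) \<in> parcs G. c u \<noteq> c v)"

text \<open>
  For a finite loopless graph, \<open>SUP\<close> is a maximum and \<open>INF\<close> is attained. The only exception is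
  the graph without vertices, where the maximum over the empty set is read as \<open>0\<close>. Restricting
  to colors in \<open>nat\<close> is no loss, as a coloring of a finite graph uses finitely many colors.
\<close>

definition local_chromatic_number :: "'a pair_pre_digraph \<Rightarrow> nat" where
  "local_chromatic_number G =
     (INF c \<in> {c :: 'a \<Rightarrow> nat. proper_coloring G c}.
        SUP v \<in> pverts G. card (c ` (parcs G `` {v}))) + 1"

definition looped_path :: "nat \<Rightarrow> nat pair_pre_digraph" where
  "looped_path r = \<lparr>pverts = {0..r},
     parcs = {(i - 1, i) | i. i \<in> {1..r}} \<union> {(i, i - 1) | i. i \<in> {1..r}} \<union> {(0, 0)}\<rparr>"

definition direct_product ::
    "'a pair_pre_digraph \<Rightarrow> 'b pair_pre_digraph \<Rightarrow> ('a \<times> 'b) pair_pre_digraph" where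
  "direct_product H G = \<lparr>pverts = pverts H \<times> pverts G,
     parcs = {((a, u), (a', u')). (a, a') \<in> parcs H \<and> (u, u') \<in> parcs G}\<rparr>"

definition image_graph :: "('a \<Rightarrow> 'b) \<Rightarrow> 'a pair_pre_digraph \<Rightarrow> 'b pair_pre_digraph" where
  "image_graph f G = \<lparr>pverts = f ` pverts G, parcs = map_prod f f ` parcs G\<rparr>"

text \<open>
  One vertex type that is closed under the Mycielski construction, so that the construction can
  be iterated: \<open>Orig x\<close> is a vertex of the initial graph, \<open>Level a u\<close> is the vertex \<open>(a, u)\<close> with
  \<open>a < r\<close>, and \<open>Apex\<close> is the vertex into which all the \<open>(r, u)\<close> are identified. At each step
  the vertices \<open>u\<close> of the previous graph, including its apex, occur only below a \<open>Level\<close>, so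
  the new apex is distinct from them.
\<close>

datatype 'a mvertex = Orig 'a | Level nat "'a mvertex" | Apex

definition identify_top :: "nat \<Rightarrow> nat \<times> 'a mvertex \<Rightarrow> 'a mvertex" where
  "identify_top r = (\<lambda>(a, u). if a = r then Apex else Level a u)"

definition gen_mycielskian ::
    "nat \<Rightarrow> 'a mvertex pair_pre_digraph \<Rightarrow> 'a mvertex pair_pre_digraph" where
  "gen_mycielskian r G = image_graph (identify_top r) (direct_product (looped_path r) G)"

text \<open>The head of the list is the parameter of the innermost construction, which is applied first.\<close>

definition iter_mycielskian ::
    "nat list \<Rightarrow> 'a pair_pre_digraph \<Rightarrow> 'a mvertex pair_pre_digraph" where
  "iter_mycielskian rs G = fold gen_mycielskian rs (image_graph Orig G)"

end

theory Submission
  imports Defs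
begin

text \<open>
  Start from an optimal local coloring of \<open>G\<close>. In each Mycielski step, the vertices on levels at
  least \<open>3\<close> are recolored: the odd levels with a new color \<open>Stage n\<close>, where \<open>n\<close> counts the
  steps, and the even levels with the color \<open>Even\<close>, which is the same for all steps. The result
  satisfies a weak form of the wideness of Simonyi and Tardos (no two vertices of the same color
  are the ends of a walk of length \<open>5\<close>): if the ends of the walk have color \<open>Stage i\<close>, then the
  two middle vertices cannot both have a color \<open>Stage k\<close> with \<open>k \<le> i\<close>.

  A neighbor \<open>y\<close> of \<open>x\<close> with color \<open>Stage k\<close> receives one extra color if \<open>x\<close> sees more than
  \<open>n / 2\<close> of the colors \<open>Stage i\<close> with \<open>i \<ge> k\<close>, so at most half of the stages remain visible from
  \<open>x\<close>. If two adjacent vertices \<open>y\<close>, \<open>y'\<close> both received it, the two majorities responsible for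
  this would have a common member \<open>i\<close>, and \<open>i\<close> would be at least the stages of \<open>y\<close> and \<open>y'\<close>,
  against wideness.
\<close>

section \<open>Stage colorings and weak wideness\<close>

datatype color = Stage nat | Even | Old nat

instance color :: countable
  by countable_datatype

definition stages_seen :: "'v pair_pre_digraph \<Rightarrow> ('v \<Rightarrow> color) \<Rightarrow> 'v \<Rightarrow> nat set" where
  "stages_seen H c x = {i. \<exists>z. (x, z) \<in> parcs H \<and> c z = Stage i}"

text \<open>The walk of length 5 is \<open>z\<close>, \<open>x\<close>, \<open>y\<close>,
  \<open>y'\<close>, \<open>x'\<close>, \<open>z'\<close>; its first and last arcs are hidden in
  \<open>stages_seen\<close>.\<close>

definition ranked_wide :: "'v pair_pre_digraph \<Rightarrow> ('v \<Rightarrow> color) \<Rightarrow> bool" where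
  "ranked_wide H c \<longleftrightarrow>
     (\<forall>x y y' x' i k k'. (x, y) \<in> parcs H \<longrightarrow> (y, y') \<in> parcs H \<longrightarrow> (x', y') \<in> parcs H \<longrightarrow>
        c y = Stage k \<longrightarrow> c y' = Stage k' \<longrightarrow> k \<le> i \<longrightarrow> k' \<le> i \<longrightarrow>
        i \<in> stages_seen H c x \<longrightarrow> i \<notin> stages_seen H c x')"

text \<open>A finite superset \<open>S\<close> is asked for because \<open>card\<close> of an
  infinite set is 0 and \<open>H\<close> need not be finite.\<close>

definition stage_coloring ::
    "'v pair_pre_digraph \<Rightarrow> ('v \<Rightarrow> color) \<Rightarrow> nat \<Rightarrow> nat \<Rightarrow> bool" where
  "stage_coloring H c n p \<longleftrightarrow>
     proper_coloring H c \<and> ranked_wide H c \<and> (\<forall>v i. c v = Stage i \<longrightarrow> i < n) \<and>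
     (\<forall>x. \<exists>S. finite S \<and> card S \<le> p \<and> {m. \<exists>z. (x, z) \<in> parcs H \<and> c z = Old m} \<subseteq> S)"

section \<open>Lifting through one Mycielski step\<close>

fun level :: "nat \<Rightarrow> 'a mvertex \<Rightarrow> nat" where
  "level r Apex = r"
| "level r (Level a u) = a"
| "level r (Orig x) = 0"

fun base :: "'a mvertex \<Rightarrow> 'a mvertex" where
  "base (Level a u) = u"
| "base v = v"

text \<open>An even level from 4 on meets only levels of color \<open>Stage n\<close>, so all steps
  can share \<open>Even\<close>. For \<open>r \<ge> 4\<close> the apex, on level \<open>r\<close>,
  is recolored by parity as well.\<close>

definition lift_coloring :: "nat \<Rightarrow> nat \<Rightarrow> ('a mvertex \<Rightarrow> color) \<Rightarrow> 'a mvertex \<Rightarrow> color" where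
  "lift_coloring r n c v =
     (if level r v \<ge> 3 then (if odd (level r v) then Stage n else Even) else c (base v))"

lemma gen_mycielskian_arc_level:
  assumes "(v, w) \<in> parcs (gen_mycielskian r H)"
  shows "level r v = Suc (level r w) \<or> level r w = Suc (level r v) \<or> level r v = 0 \<and> level r w = 0"
proof -
  have "level r (identify_top r (a, u)) = a" for a and u :: "'a mvertex"
    by (simp add: identify_top_def)
  then show ?thesis
    using assms unfolding gen_mycielskian_def image_graph_def direct_product_def looped_path_def
    by (auto simp del: One_nat_def)
qed

lemma gen_mycielskian_arc_base:
  assumes "(v, w) \<in> parcs (gen_mycielskian r H)" "level r v < r" "level r w < r"
  shows "(base v, base w) \<in> parcs H"
  using assms unfolding gen_mycielskian_def image_graph_def direct_product_def
  by (auto simp: identify_top_def split: if_splits)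

text \<open>A forbidden walk with ends of the new color is excluded by parity. Any other one stays
  on levels at most 3, below the apex as \<open>r \<ge> 4\<close>, and projects to a forbidden walk
  in \<open>H\<close>.\<close>

lemma stage_coloring_lift:
  assumes H: "stage_coloring H c n p" and r: "r \<ge> 4"
  shows "stage_coloring (gen_mycielskian r H) (lift_coloring r n c) (Suc n) p"
proof -
  let ?M = "gen_mycielskian r H" and ?c = "lift_coloring r n c" and ?l = "level r"
  note lev = gen_mycielskian_arc_level[of _ _ r H]
  have old: "\<And>v. c v \<noteq> Stage n" and lt: "\<And>v i. c v = Stage i \<Longrightarrow> i < n"
    and neq: "\<And>v w. (v, w) \<in> parcs H \<Longrightarrow> c v \<noteq> c w" and wide: "ranked_wide H c"
    using H by (auto simp: stage_coloring_def proper_coloring_def)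
  have low: "?l v \<le> 2 \<and> c (base v) = Stage i" if "?c v = Stage i" "i < n" for v i
    using that by (auto simp: lift_coloring_def split: if_splits)
  have top: "?l v \<ge> 3 \<and> odd (?l v)" if "?c v = Stage n" for v
    using that old by (auto simp: lift_coloring_def split: if_splits)
  have le: "i \<le> n" if "?c v = Stage i" for v i
    using that lt[of "base v" i] by (auto simp: lift_coloring_def split: if_splits)
  have arc: "(base v, base w) \<in> parcs H" if "(v, w) \<in> parcs ?M" "?l v \<le> 3" "?l w \<le> 3" for v w
    using gen_mycielskian_arc_base[OF that(1)] that r by simp
  have "proper_coloring ?M ?c"
    unfolding proper_coloring_def
  proof clarify
    fix v w assume vw: "(v, w) \<in> parcs ?M" and eq: "?c v = ?c w"
    show False
    proof (cases "?l v \<le> 2 \<and> ?l w \<le> 2")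
      case True
      then show ?thesis using neq[OF arc[OF vw]] eq by (simp add: lift_coloring_def)
    next
      case False
      \<comment> \<open>Old and new colors meet only between levels 2 and 3, where
        \<open>Stage n\<close> is new to \<open>c\<close>.\<close>
      then consider "?l v \<ge> 3" "?l w \<ge> 3" | "?l v = 3" "?l w = 2" | "?l v = 2" "?l w = 3"
        using lev[OF vw] by linarith
      then show ?thesis
      proof cases
        case 1
        then show ?thesis using lev[OF vw] eq by (auto simp: lift_coloring_def split: if_splits)
      next
        case 2
        then show ?thesis using eq old[of "base w"] by (simp add: lift_coloring_def)
      next
        case 3
        then show ?thesis using eq old[of "base v"] by (simp add: lift_coloring_def)
      qed
    qed
  qed
  moreover have "ranked_wide ?M ?c"
    unfolding ranked_wide_def
  proof (intro allI impI notI)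
    fix x y y' x' i k k'
    assume xy: "(x, y) \<in> parcs ?M" and yy: "(y, y') \<in> parcs ?M" and xy': "(x', y') \<in> parcs ?M"
      and k: "?c y = Stage k" "k \<le> i" and k': "?c y' = Stage k'" "k' \<le> i"
      and "i \<in> stages_seen ?M ?c x" "i \<in> stages_seen ?M ?c x'"
    then obtain z z' where xz: "(x, z) \<in> parcs ?M" and z: "?c z = Stage i"
      and xz': "(x', z') \<in> parcs ?M" and z': "?c z' = Stage i"
      by (auto simp: stages_seen_def)
    show False
    proof (cases "i = n")
      case True
      then have z3: "?l z \<ge> 3" "odd (?l z)" "?l z' \<ge> 3" "odd (?l z')"
        using top z z' by auto
      \<comment> \<open>Two steps from level at least 3 do not reach level 0, so the walk avoids the
        arcs within level 0. All five arcs change parity, yet both ends are odd.\<close>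
      then have "?l x \<ge> 2" "?l x' \<ge> 2"
        using lev[OF xz] lev[OF xz'] by linarith+
      moreover from this have "?l y \<ge> 1" "?l y' \<ge> 1"
        using lev[OF xy] lev[OF xy'] by linarith+
      moreover have flip: "even (?l v) \<longleftrightarrow> odd (?l w)" if "(v, w) \<in> parcs ?M" "?l v \<ge> 1" for v w
        using lev[OF that(1)] that(2) by auto
      ultimately show ?thesis
        using z3(2,4) flip[OF xz] flip[OF xy] flip[OF yy] flip[OF xy'] flip[OF xz'] by auto
    next
      case False
      then have "i < n" using le[OF z] by simp
      \<comment> \<open>The rank condition keeps the middle low: its stages are at most
        \<open>i < n\<close>, hence come from \<open>c\<close> on levels at most 2.\<close>
      note lows = low[OF z this] low[OF z' this] low[OF k(1) le_less_trans[OF k(2) this]]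
        low[OF k'(1) le_less_trans[OF k'(2) this]]
      then have lx: "?l x \<le> 3" "?l x' \<le> 3"
        using lev[OF xz] lev[OF xz'] by linarith+
      have "i \<in> stages_seen H c (base x)" "i \<in> stages_seen H c (base x')"
        using arc[OF xz] arc[OF xz'] lx lows by (auto simp: stages_seen_def)
      moreover have "(base x, base y) \<in> parcs H" "(base y, base y') \<in> parcs H"
          "(base x', base y') \<in> parcs H"
        using arc[OF xy] arc[OF yy] arc[OF xy'] lx lows by auto
      ultimately show ?thesis
        using wide k(2) k'(2) lows unfolding ranked_wide_def by blast
    qed
  qed
  moreover have "\<forall>v i. ?c v = Stage i \<longrightarrow> i < Suc n"
    using le by (auto simp: less_Suc_eq_le)
  moreover have "\<exists>S. finite S \<and> card S \<le> p \<and> {m. \<exists>z. (x, z) \<in> parcs ?M \<and> ?c z = Old m} \<subseteq> S" for x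
  proof -
    obtain S where S: "finite S" "card S \<le> p"
      "{m. \<exists>z. (base x, z) \<in> parcs H \<and> c z = Old m} \<subseteq> S"
      using H unfolding stage_coloring_def by meson
    \<comment> \<open>A neighbor of color \<open>Old m\<close> has level at most 2, so the arc to it
      projects to \<open>H\<close>, and the set \<open>S\<close> of \<open>base x\<close> serves for
      \<open>x\<close>.\<close>
    have "(base x, base z) \<in> parcs H \<and> c (base z) = Old m"
      if "(x, z) \<in> parcs ?M" "?c z = Old m" for z m
    proof -
      have "?l z \<le> 2" "c (base z) = Old m"
        using that(2) by (auto simp: lift_coloring_def split: if_splits)
      then show ?thesis using arc[OF that(1)] lev[OF that(1)] by auto
    qed
    then show ?thesis using S by (intro exI[of _ S]) blast
  qed
  ultimately show ?thesis by (simp add: stage_coloring_def)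
qed

section \<open>Initial colorings and iteration\<close>

text \<open>With at most one stage, adjacent vertices never both have stage colors, so wideness is
  vacuous. A general graph starts with \<open>n = 0\<close>, the complete graph on two vertices with
  \<open>n = 1\<close>.\<close>

lemma stage_coloring_few_stages:
  assumes "proper_coloring H c" "\<And>v i. c v = Stage i \<Longrightarrow> i < n" "n \<le> 1"
    and "\<And>x. \<exists>S. finite S \<and> card S \<le> p \<and> {m. \<exists>z. (x, z) \<in> parcs H \<and> c z = Old m} \<subseteq> S"
  shows "stage_coloring H c n p"
proof -
  have "c v = c w" if "c v = Stage i" "c w = Stage j" for v w i j
    using assms(2)[OF that(1)] assms(2)[OF that(2)] assms(3) that by simp
  moreover have "c v \<noteq> c w" if "(v, w) \<in> parcs H" for v w
    using assms(1) that by (auto simp: proper_coloring_def)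
  ultimately have "ranked_wide H c"
    unfolding ranked_wide_def by blast
  then show ?thesis
    using assms by (simp add: stage_coloring_def)
qed

lemma stage_coloring_iter:
  assumes "stage_coloring G g n p" "\<forall>r \<in> set rs. r \<ge> 4"
  shows "\<exists>c. stage_coloring (iter_mycielskian rs G) c (n + length rs) p"
  using assms(2)
\<comment> \<open>The last entry of \<open>rs\<close> is the outermost construction.\<close>
proof (induction rs rule: rev_induct)
  case Nil
  define c :: "'a mvertex \<Rightarrow> color" where
    "c = (\<lambda>v. case v of Orig u \<Rightarrow> g u | _ \<Rightarrow> Even)"
  let ?O = "image_graph Orig G"
  have c: "c (Orig u) = g u" for u by (simp add: c_def)
  have cl: "\<exists>u. v = Orig u \<and> g u = Stage i" if "c v = Stage i" for v i
    using that by (cases v) (auto simp: c_def)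
  have arc: "(v, w) \<in> parcs ?O \<longleftrightarrow> (\<exists>x y. v = Orig x \<and> w = Orig y \<and> (x, y) \<in> parcs G)" for v w
    by (force simp: image_graph_def map_prod_def)
  have seen: "stages_seen ?O c (Orig x) = stages_seen G g x" for x
    by (auto simp: stages_seen_def arc c)
  have "proper_coloring ?O c"
    using assms(1) by (fastforce simp: stage_coloring_def proper_coloring_def arc c)
  moreover have "ranked_wide ?O c"
    unfolding ranked_wide_def arc
  proof (clarsimp simp: seen c)
    fix i k k' x y y' x'
    assume "(x, y) \<in> parcs G" "(y, y') \<in> parcs G" "(x', y') \<in> parcs G" "g y = Stage k"
      "g y' = Stage k'" "k \<le> i" "k' \<le> i" "i \<in> stages_seen G g x" "i \<in> stages_seen G g x'"
    then show False
      using assms(1) unfolding stage_coloring_def ranked_wide_def by blast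
  qed
  moreover have "\<exists>S. finite S \<and> card S \<le> p \<and> {m. \<exists>z. (x, z) \<in> parcs ?O \<and> c z = Old m} \<subseteq> S" for x
  proof (cases "\<exists>u. x = Orig u")
    case True
    then obtain u where x: "x = Orig u" by blast
    obtain S where S: "finite S" "card S \<le> p" "{m. \<exists>z. (u, z) \<in> parcs G \<and> g z = Old m} \<subseteq> S"
      using assms(1) unfolding stage_coloring_def by meson
    have "{m. \<exists>z. (x, z) \<in> parcs ?O \<and> c z = Old m} \<subseteq> {m. \<exists>z. (u, z) \<in> parcs G \<and> g z = Old m}"
      by (auto simp: arc c x)
    with S show ?thesis by (intro exI[of _ S] conjI) (assumption | rule order_trans)+
  next
    case False
    then show ?thesis by (intro exI[of _ "{}"]) (auto simp: arc)
  qed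
  moreover have "i < n" if "c v = Stage i" for v i
    using cl[OF that] assms(1) by (auto simp: stage_coloring_def)
  ultimately have "stage_coloring ?O c n p"
    by (simp add: stage_coloring_def)
  then show ?case by (auto simp: iter_mycielskian_def)
next
  case (snoc r rs)
  then obtain c where "stage_coloring (iter_mycielskian rs G) c (n + length rs) p"
    by auto
  from stage_coloring_lift[OF this, of r] snoc.prems show ?case
    by (auto simp: iter_mycielskian_def)
qed

section \<open>The local chromatic number as an attained minimum\<close>

lemma local_chromatic_number_le:
  assumes "proper_coloring G (c :: 'a \<Rightarrow> 'c::countable)"
    and "\<And>v. card (c ` (parcs G `` {v})) \<le> k"
  shows "local_chromatic_number G \<le> k + 1"
proof -
  let ?f = "\<lambda>c :: 'a \<Rightarrow> nat. SUP v \<in> pverts G. card (c ` (parcs G `` {v}))"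
  have "proper_coloring G (to_nat \<circ> c)"
    using assms(1) by (auto simp: proper_coloring_def)
  then have "(INF c \<in> {c. proper_coloring G c}. ?f c) \<le> ?f (to_nat \<circ> c)"
    by (intro cINF_lower) auto
  also have "card ((to_nat \<circ> c) ` (parcs G `` {v})) \<le> k" for v
    using assms(2)[of v] card_image[of to_nat "c ` (parcs G `` {v})"]
    by (simp add: image_comp inj_on_def)
  then have "?f (to_nat \<circ> c) \<le> k"
    by (cases "pverts G = {}") (auto intro: cSUP_least)
  finally show ?thesis by (simp add: local_chromatic_number_def)
qed

lemma local_chromatic_number_attained:
  assumes "pair_graph G"
  obtains c :: "'a \<Rightarrow> nat" where "proper_coloring G c"
    "\<And>v. card (c ` (parcs G `` {v})) \<le> local_chromatic_number G - 1"
proof -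
  interpret pair_graph G by fact
  let ?f = "\<lambda>c :: 'a \<Rightarrow> nat. SUP v \<in> pverts G. card (c ` (parcs G `` {v}))"
  \<comment> \<open>A coloring injective on the vertices is proper in a loopless graph, so the
    infimum is over a nonempty set of naturals and is attained.\<close>
  obtain h :: "'a \<Rightarrow> nat" where "inj_on h (pverts G)"
    using finite_imp_inj_to_nat_seg[OF pair_finite_verts] by blast
  moreover have "u \<in> pverts G \<and> v \<in> pverts G \<and> u \<noteq> v" if "(u, v) \<in> parcs G" for u v
    using that in_arcsD1 in_arcsD2 no_loops[of "(u, v)"] by auto
  ultimately have "proper_coloring G h"
    by (auto simp: proper_coloring_def dest: inj_onD)
  then have "(INF c \<in> {c. proper_coloring G c}. ?f c) \<in> ?f ` {c. proper_coloring G c}"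
    by (intro Inf_nat_def1) auto
  then obtain c where c: "proper_coloring G c" "?f c = local_chromatic_number G - 1"
    by (auto simp: local_chromatic_number_def)
  have "card (c ` (parcs G `` {v})) \<le> ?f c" for v
  proof (cases "v \<in> pverts G")
    case True
    then show ?thesis by (intro cSUP_upper) auto
  next
    case False
    then have "parcs G `` {v} = {}" by (auto dest: in_arcsD1)
    then show ?thesis by simp
  qed
  with c that show thesis by simp
qed

section \<open>Recoloring by majorities\<close>

text \<open>After recoloring, a vertex sees at most \<open>p\<close> colors \<open>Old\<close>,
  \<open>n div 2\<close> stages, \<open>Even\<close> and the extra color \<open>None\<close>; the
  definition of the number adds 1.\<close>

lemma local_chromatic_number_stage_coloring:
  assumes H: "stage_coloring H c n p"
  shows "local_chromatic_number H \<le> p + n div 2 + 3"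
proof -
  define I where "I x k = {i \<in> stages_seen H c x. k \<le> i}" for x k
  \<comment> \<open>Some neighbor \<open>x\<close> with a majority suffices: the new color of
    \<open>y\<close> must not depend on which neighbor looks at it.\<close>
  define Y where "Y = {y. \<exists>x k. c y = Stage k \<and> (x, y) \<in> parcs H \<and> n < 2 * card (I x k)}"
  define e where "e y = (if y \<in> Y then None else Some (c y))" for y
  have seen: "stages_seen H c x \<subseteq> {..<n}" for x
    using H by (auto simp: stages_seen_def stage_coloring_def)
  have I: "I x k \<subseteq> {..<n}" for x k
    using seen by (auto simp: I_def)
  then have fin: "finite (I x k)" for x k
    using finite_subset by blast
  have "\<not> (y \<in> Y \<and> y' \<in> Y)" if yy: "(y, y') \<in> parcs H" for y y'
  proof
    assume "y \<in> Y \<and> y' \<in> Y"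
    then obtain x k x' k' where k: "c y = Stage k" "(x, y) \<in> parcs H" "n < 2 * card (I x k)"
      and k': "c y' = Stage k'" "(x', y') \<in> parcs H" "n < 2 * card (I x' k')"
      by (auto simp: Y_def)
    have "card (I x k \<union> I x' k') \<le> card {..<n}"
      using I by (intro card_mono) auto
    then have "I x k \<inter> I x' k' \<noteq> {}"
      using k(3) k'(3) card_Un_disjoint[OF fin fin, of x k x' k'] by auto
    then obtain i where "k \<le> i" "k' \<le> i" "i \<in> stages_seen H c x" "i \<in> stages_seen H c x'"
      by (auto simp: I_def)
    then show False
      using H yy k(1,2) k'(1,2) unfolding stage_coloring_def ranked_wide_def by blast
  qed
  moreover have "c y \<noteq> c y'" if "(y, y') \<in> parcs H" for y y'
    using H that by (auto simp: proper_coloring_def stage_coloring_def)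
  ultimately have "proper_coloring H e"
    by (force simp: proper_coloring_def e_def split: if_splits)
  moreover have "card (e ` (parcs H `` {x})) \<le> p + n div 2 + 2" for x
  proof -
    define K where "K = {k \<in> stages_seen H c x. 2 * card (I x k) \<le> n}"
    obtain S where S: "finite S" "card S \<le> p" "{m. \<exists>z. (x, z) \<in> parcs H \<and> c z = Old m} \<subseteq> S"
      using H unfolding stage_coloring_def by meson
    have finK: "finite K"
      using seen[of x] finite_subset[of K "{..<n}"] by (auto simp: K_def)
    have K: "card K \<le> n div 2"
    \<comment> \<open>All of \<open>K\<close> lies at or above its minimum, hence in
      \<open>I x (Min K)\<close>, which is no majority.\<close>
    proof (cases "K = {}")
      case False
      then have "Min K \<in> K" using finK by (rule Min_in[rotated])
      then have "2 * card (I x (Min K)) \<le> n" unfolding K_def by blast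
      moreover have "K \<subseteq> I x (Min K)"
        using Min_le[OF finK] by (auto simp: I_def K_def)
      ultimately show ?thesis
        using card_mono[OF fin, of K x "Min K"] by linarith
    qed simp
    let ?C = "{None, Some Even} \<union> (Some \<circ> Stage) ` K \<union> (Some \<circ> Old) ` S"
    have "e z \<in> ?C" if z: "(x, z) \<in> parcs H" for z
    proof (cases "z \<in> Y")
      case False
      show ?thesis
      proof (cases "c z")
        case (Stage k)
        \<comment> \<open>Otherwise \<open>x\<close> itself would put \<open>z\<close> into
          \<open>Y\<close>.\<close>
        then have "k \<in> K"
          using z False by (force simp: K_def Y_def stages_seen_def)
        then show ?thesis using Stage False by (simp add: e_def)
      next
        case (Old m)
        then have "m \<in> S" using S(3) z by blast
        then show ?thesis using Old False by (simp add: e_def)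
      qed (simp add: e_def False)
    qed (simp add: e_def)
    then have "card (e ` (parcs H `` {x})) \<le> card ?C"
      using finK S(1) by (intro card_mono image_subsetI) simp_all
    also have "\<dots> \<le> card {None, Some Even} + card ((Some \<circ> Stage) ` K) + card ((Some \<circ> Old) ` S)"
      by (meson card_Un_le add_le_mono1 order_trans)
    also have "\<dots> \<le> 2 + card K + card S"
      using card_image_le[OF finK, of "Some \<circ> Stage"] card_image_le[OF S(1), of "Some \<circ> Old"]
      by (simp add: card_insert_if)
    finally show ?thesis using K S(2) by simp
  qed
  ultimately show ?thesis
    using local_chromatic_number_le[of H e "p + n div 2 + 2"] by simp
qed

theorem theorem4p9:
  fixes G :: "'a pair_pre_digraph" and d :: nat and rs :: "nat list"
  assumes "pair_graph G"
    and "d \<ge> 1"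
    and "length rs = d"
    and "\<forall>r \<in> set rs. r \<ge> 4"
  shows "int (local_chromatic_number (iter_mycielskian rs G))
           \<le> int (local_chromatic_number G) + \<lfloor>real d / 2\<rfloor> + 2
         \<and> (complete_digraph 2 (with_proj G) \<longrightarrow>
              int (local_chromatic_number (iter_mycielskian rs G)) \<le> \<lceil>real d / 2\<rceil> + 3)"
proof (intro conjI impI)
  interpret pair_graph G by fact
  have bound: "local_chromatic_number (iter_mycielskian rs G) \<le> p + (n + d) div 2 + 3"
    if "stage_coloring G g n p" for g n p
    using stage_coloring_iter[OF that assms(4)] local_chromatic_number_stage_coloring assms(3)
    by blast
  have floor: "\<lfloor>real d / 2\<rfloor> = int (d div 2)"
    using floor_divide_of_nat_eq[of d 2] by simp
  \<comment> \<open>The summand 1 is the initial stage in the case of two vertices; it turns the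
    floor into a ceiling.\<close>
  have ceil: "\<lceil>real d / 2\<rceil> = int ((1 + d) div 2)"
    by (cases "even d") (auto elim!: evenE oddE simp: ceiling_eq_iff)
  show "int (local_chromatic_number (iter_mycielskian rs G))
           \<le> int (local_chromatic_number G) + \<lfloor>real d / 2\<rfloor> + 2"
  proof -
    obtain c :: "'a \<Rightarrow> nat" where c: "proper_coloring G c"
      "\<And>v. card (c ` (parcs G `` {v})) \<le> local_chromatic_number G - 1"
      using local_chromatic_number_attained[OF assms(1)] by blast
    have "stage_coloring G (Old \<circ> c) 0 (local_chromatic_number G - 1)"
    proof (rule stage_coloring_few_stages)
      fix x
      have "finite (parcs G `` {x})" by (simp add: finite_Image)
      then show "\<exists>S. finite S \<and> card S \<le> local_chromatic_number G - 1 \<and>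
          {m. \<exists>z. (x, z) \<in> parcs G \<and> (Old \<circ> c) z = Old m} \<subseteq> S"
        using c(2) by (intro exI[of _ "c ` (parcs G `` {x})"]) auto
    qed (use c(1) in \<open>auto simp: proper_coloring_def\<close>)
    \<comment> \<open>This makes the truncated subtraction exact, so that subtracting 1 and adding 3
      gives the summand 2.\<close>
    moreover have "local_chromatic_number G \<ge> 1"
      by (simp add: local_chromatic_number_def)
    ultimately show ?thesis
      using bound[of "Old \<circ> c" 0 "local_chromatic_number G - 1"] unfolding floor by linarith
  qed
  assume "complete_digraph 2 (with_proj G)"
  then have "card (pverts G) = 2"
    by (auto simp: complete_digraph_def)
  then obtain a b where ab: "pverts G = {a, b}" "a \<noteq> b"
    by (auto simp: card_2_iff)
  \<comment> \<open>One vertex of \<open>K\<^sub>2\<close> shares the color \<open>Even\<close> of the Mycielski steps, the other counts as an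
    additional stage.\<close>
  define g where "g v = (if v = a then Stage 0 else Even)" for v
  have "stage_coloring G g 1 0"
  proof (rule stage_coloring_few_stages)
    show "proper_coloring G g"
      unfolding proper_coloring_def
    proof clarify
      fix u v assume uv: "(u, v) \<in> parcs G" "g u = g v"
      then have "u \<in> {a, b}" "v \<in> {a, b}" "u \<noteq> v"
        using in_arcsD1 in_arcsD2 no_loops[of "(u, v)"] ab(1) by auto
      then show False using uv(2) ab(2) by (auto simp: g_def split: if_splits)
    qed
  qed (auto simp: g_def split: if_splits)
  from bound[OF this]
  show "int (local_chromatic_number (iter_mycielskian rs G)) \<le> \<lceil>real d / 2\<rceil> + 3"
    by (simp add: ceil)
qed

end
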